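(* Let $\Theta$ be a non-empty set and let $(H_\theta)_{\theta\in\Theta}$, $(M(\theta))_{\theta\in\Theta}$, $(A(\theta))_{\theta\in\Theta}$, $c>0$, $(N(\theta))_{\theta\in\Theta}$ satisfy the standing assumptions and the fibre hypothesis stated in the context. Then for all $\varepsilon\in\big(0,\tfrac{1}{2C_R\|M\|_\infty}\big)$ and all $\theta\in\Theta$ one has $$\Big\|\mathcal{B}_\varepsilon(\theta)^{-1}-\big(\pi_{N(\theta)}M(\theta)\pi_{N(\theta)}+\tfrac1\varepsilon A(\theta)\big)^{-1}\Big\|\le \kappa\,\varepsilon,\qquad \kappa:=2C_R\Big(1+\frac{\|M\|_\infty}{c}\Big)^2+C_R,$$ where $\|\cdot\|$ is the operator norm on $L(H_\theta)$ (in particular both inverses exist as bounded operators on $H_\theta$).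
   Context: Standing assumptions. $\Theta$ is a non-empty set, $(H_\theta)_{\theta\in\Theta}$ is a family of Hilbert spaces, $M(\theta)\in L(H_\theta)$ (bounded linear operators) with $\|M\|_\infty:=\sup_{\theta\in\Theta}\|M(\theta)\|<\infty$, and $A(\theta):\operatorname{dom}(A(\theta))\subseteq H_\theta\to H_\theta$ is densely defined and closed. There is $c\in(0,\infty)$ such that for all $\theta\in\Theta$: $\operatorname{Re}M(\theta):=\tfrac12(M(\theta)+M(\theta)^* )\ge c$ and $A(\theta)=-A(\theta)^*$. For $\varepsilon>0$ put $\mathcal{B}_\varepsilon(\theta):=M(\theta)+\tfrac1\varepsilon A(\theta)$ with domain $\operatorname{dom}(A(\theta))$. Fibre hypothesis. For every $\theta\in\Theta$ there is given a closed subspace $N(\theta)\subseteq H_\theta$; put $R(\theta):=N(\theta)^\perp$, let $\iota_{N(\theta)}:N(\theta)\hookrightarrow H_\theta$, $\iota_{R(\theta)}:R(\theta)\hookrightarrow H_\theta$ be the canonical embeddings and $\pi_{N(\theta)}:=\iota_{N(\theta)}\iota_{N(\theta)}^*$, $\pi_{R(\theta)}:=\iota_{R(\theta)}\iota_{R(\theta)}^*$ the orthogonal projections, such that (a) $A(\theta)\pi_{N(\theta)}$ is bounded for all $\theta\in\Theta$; (b) $\pi_{R(\theta)}A(\theta)\subseteq A(\theta)\pi_{R(\theta)}$ (inclusion of operators) for all $\theta\in\Theta$; (c) $\iota_{R(\theta)}^*A(\theta)\iota_{R(\theta)}$ is boundedly invertible on $R(\theta)$, uniformly in $\theta$: $C_R:=\sup_{\theta\in\Theta}\|(\iota_{R(\theta)}^*A(\theta)\iota_{R(\theta)})^{-1}\|_{L(R(\theta))}<\infty$.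 *)

theory Defs
  imports "HOL-Analysis.Analysis"
begin

section \<open>Complex inner product spaces\<close>

text \<open>The inner product is linear in the second argument, and its real part is the inner product of
  the underlying real space. Hence norm, metric and topology are those of \<^class>\<open>real_inner\<close>.\<close>

class complex_inner = real_inner +
  fixes scaleC :: "complex \<Rightarrow> 'a \<Rightarrow> 'a"  (infixr \<open>*\<^sub>C\<close> 75)
    and cinner :: "'a \<Rightarrow> 'a \<Rightarrow> complex"
  assumes scaleC_add_right: "a *\<^sub>C (x + y) = a *\<^sub>C x + a *\<^sub>C y"
    and scaleC_add_left: "(a + b) *\<^sub>C x = a *\<^sub>C x + b *\<^sub>C x"
    and scaleC_scaleC: "a *\<^sub>C b *\<^sub>C x = (a * b) *\<^sub>C x"
    and scaleR_eq_scaleC: "r *\<^sub>R x = complex_of_real r *\<^sub>C x"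
    and cinner_commute: "cinner x y = cnj (cinner y x)"
    and cinner_add_right: "cinner x (y + z) = cinner x y + cinner x z"
    and cinner_scaleC_right: "cinner x (a *\<^sub>C y) = a * cinner x y"
    and inner_eq_Re_cinner: "inner x y = Re (cinner x y)"

lemma scaleC_one: "1 *\<^sub>C x = (x :: 'a::complex_inner)"
  by (metis of_real_1 scaleR_eq_scaleC scaleR_one)

global_interpretation complex_vector: vector_space "scaleC :: complex \<Rightarrow> 'a \<Rightarrow> 'a::complex_inner"
  by unfold_locales (simp_all add: scaleC_add_right scaleC_add_left scaleC_scaleC scaleC_one)

instantiation complex :: complex_inner
begin

definition scaleC_complex :: "complex \<Rightarrow> complex \<Rightarrow> complex" where
  "scaleC_complex a x = a * x"

definition cinner_complex :: "complex \<Rightarrow> complex \<Rightarrow> complex" where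
  "cinner_complex x y = cnj x * y"

instance
  by standard
    (simp_all add: scaleC_complex_def cinner_complex_def algebra_simps inner_complex_def
      scaleR_conv_of_real)

end

instantiation prod :: (complex_inner, complex_inner) complex_inner
begin

definition scaleC_prod :: "complex \<Rightarrow> 'a \<times> 'b \<Rightarrow> 'a \<times> 'b" where
  "scaleC_prod a p = (a *\<^sub>C fst p, a *\<^sub>C snd p)"

definition cinner_prod :: "'a \<times> 'b \<Rightarrow> 'a \<times> 'b \<Rightarrow> complex" where
  "cinner_prod p q = cinner (fst p) (fst q) + cinner (snd p) (snd q)"

instance
proof
  fix p q :: "'a \<times> 'b"
  show "cinner p q = cnj (cinner q p)"
    by (simp add: cinner_prod_def cinner_commute[symmetric])
qed (simp_all add: scaleC_prod_def cinner_prod_def scaleC_add_right scaleC_add_left scaleC_scaleC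
      scaleR_prod_def scaleR_eq_scaleC cinner_add_right cinner_scaleC_right algebra_simps
      inner_prod_def inner_eq_Re_cinner)

end


section \<open>Hilbert spaces as carrier sets\<close>

text \<open>A type cannot depend on an index, so the members of a family of Hilbert spaces are complete
  subspaces of one ambient complex inner product space. Up to unitary equivalence this covers every
  family, since all its members embed isometrically into their Hilbert direct sum.\<close>

definition hilbert_space :: "'a::complex_inner set \<Rightarrow> bool" where
  "hilbert_space H \<longleftrightarrow> complex_vector.subspace H \<and> complete H"

definition closed_subspace :: "'a::complex_inner set \<Rightarrow> 'a set \<Rightarrow> bool" where
  "closed_subspace N H \<longleftrightarrow> N \<subseteq> H \<and> complex_vector.subspace N \<and> closed N"

definition ortho_complement :: "'a::complex_inner set \<Rightarrow> 'a set \<Rightarrow> 'a set" where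
  "ortho_complement H N = {x \<in> H. \<forall>y\<in>N. cinner y x = 0}"


section \<open>Operators as graphs\<close>

text \<open>A linear operator with domain in \<open>H\<close> and values in \<open>K\<close> is identified with its graph. Thus its
  domain is \<^const>\<open>Domain\<close>, equality and inclusion of operators (domains included) are equality
  and inclusion of sets, the inverse is \<^const>\<open>converse\<close>, and an operator is closed iff its
  graph is a closed set.\<close>

definition operators :: "'a::complex_inner set \<Rightarrow> 'b::complex_inner set \<Rightarrow> ('a \<times> 'b) set set" where
  "operators H K = {T. T \<subseteq> H \<times> K \<and> complex_vector.subspace T \<and> single_valued T}"

definition op_bounded :: "('a::complex_inner \<times> 'b::complex_inner) set \<Rightarrow> bool" where
  "op_bounded T \<longleftrightarrow> (\<exists>C. \<forall>(x, y)\<in>T. norm y \<le> C * norm x)"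

definition bounded_operators ::
    "'a::complex_inner set \<Rightarrow> 'b::complex_inner set \<Rightarrow> ('a \<times> 'b) set set" where
  "bounded_operators H K = {T \<in> operators H K. Domain T = H \<and> op_bounded T}"

definition op_norm :: "('a::complex_inner \<times> 'b::complex_inner) set \<Rightarrow> real" where
  "op_norm T = Sup {norm y |x y. (x, y) \<in> T \<and> norm x \<le> 1}"

definition op_add :: "('a::complex_inner \<times> 'b::complex_inner) set \<Rightarrow> ('a \<times> 'b) set \<Rightarrow> ('a \<times> 'b) set"
    (infixl \<open>+\<^sub>o\<close> 65) where
  "S +\<^sub>o T = {(x, y + z) |x y z. (x, y) \<in> S \<and> (x, z) \<in> T}"

definition op_scale :: "real \<Rightarrow> ('a::complex_inner \<times> 'b::complex_inner) set \<Rightarrow> ('a \<times> 'b) set"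
    (infixr \<open>*\<^sub>o\<close> 75) where
  "r *\<^sub>o T = {(x, r *\<^sub>R y) |x y. (x, y) \<in> T}"

abbreviation op_minus :: "('a::complex_inner \<times> 'b::complex_inner) set \<Rightarrow> ('a \<times> 'b) set \<Rightarrow> ('a \<times> 'b) set"
    (infixl \<open>-\<^sub>o\<close> 65) where
  "S -\<^sub>o T \<equiv> S +\<^sub>o (-1) *\<^sub>o T"

text \<open>Relational composition \<^const>\<open>relcomp\<close> applies its left argument first; here, as usual for
  operators, the right one is applied first.\<close>

abbreviation op_comp ::
    "('b::complex_inner \<times> 'c::complex_inner) set \<Rightarrow> ('a::complex_inner \<times> 'b) set \<Rightarrow> ('a \<times> 'c) set"
    (infixl \<open>\<cdot>\<^sub>o\<close> 70) where
  "S \<cdot>\<^sub>o T \<equiv> T O S"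

text \<open>The adjoint of an operator from \<open>H\<close> to \<open>K\<close>; it is single-valued if the domain is dense
  in \<open>H\<close>.\<close>

definition adjoint_op ::
    "'a::complex_inner set \<Rightarrow> 'b::complex_inner set \<Rightarrow> ('a \<times> 'b) set \<Rightarrow> ('b \<times> 'a) set" where
  "adjoint_op H K T = {(y, z). y \<in> K \<and> z \<in> H \<and> (\<forall>(x, w)\<in>T. cinner w y = cinner x z)}"

definition real_part_op :: "'a::complex_inner set \<Rightarrow> ('a \<times> 'a) set \<Rightarrow> ('a \<times> 'a) set" where
  "real_part_op H T = (1 / 2) *\<^sub>o (T +\<^sub>o adjoint_op H H T)"

text \<open>The relation \<open>S \<ge> c\<close> for a selfadjoint operator \<open>S\<close>, for which \<open>cinner x (S x)\<close> is
  real.\<close>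

definition op_ge :: "('a::complex_inner \<times> 'a) set \<Rightarrow> real \<Rightarrow> bool" where
  "op_ge S c \<longleftrightarrow> (\<forall>(x, y)\<in>S. c * (norm x)\<^sup>2 \<le> Re (cinner x y))"

text \<open>The canonical embedding of a subspace of \<open>H\<close> into \<open>H\<close>, its adjoint, a map from \<open>H\<close> onto
  the subspace, and the orthogonal projection.\<close>

abbreviation embedding :: "'a::complex_inner set \<Rightarrow> ('a \<times> 'a) set" where
  "embedding V \<equiv> Id_on V"

abbreviation embedding_adj :: "'a::complex_inner set \<Rightarrow> 'a set \<Rightarrow> ('a \<times> 'a) set" where
  "embedding_adj H V \<equiv> adjoint_op V H (embedding V)"

definition ortho_proj :: "'a::complex_inner set \<Rightarrow> 'a set \<Rightarrow> ('a \<times> 'a) set" where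
  "ortho_proj H V = embedding V \<cdot>\<^sub>o embedding_adj H V"

end

theory Submission
  imports Defs
begin

text \<open>
  Fix one fibre and write \<open>r = 1 / \<epsilon>\<close>, \<open>\<nu> = \<parallel>M\<parallel> / c\<close>. Since \<open>A\<close> commutes with the projection onto
  \<open>R\<close>, it splits into a skew-adjoint part on \<open>N\<close> and a part on \<open>R\<close> whose inverse is bounded
  by \<open>C\<^sub>R\<close>; only \<open>M\<close> couples the two spaces. Both inverses exist. For \<open>M + r A\<close> and for
  its compression to \<open>N\<close> this is the lemma \<open>coercive_plus_skew_inverse_bounded\<close>: the operator is
  bounded below by coercivity, hence has closed range, and the orthogonal complement of the range is
  the kernel of the adjoint, which is coercive as well. The operator \<open>P M P + r A\<close>, where \<open>P\<close>
  projects onto \<open>N\<close>, is the direct sum of that compression and of \<open>r A\<close> on \<open>R\<close>.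

  For the estimate take the solutions of \<open>(M + r A) u = f\<close> and \<open>(P M P + r A) v = f\<close>, and let
  \<open>Q\<close> be the projection onto \<open>R\<close>. Coercivity gives \<open>\<parallel>M u\<parallel> \<le> \<nu> \<parallel>f\<parallel>\<close>. The \<open>R\<close>-components of the
  equations read \<open>r A Q u = Q f - Q M u\<close> and \<open>r A Q v = Q f\<close>, so that
  \<open>\<parallel>Q u\<parallel> \<le> \<epsilon> C\<^sub>R (1 + \<nu>) \<parallel>f\<parallel>\<close> and \<open>\<parallel>Q u - Q v\<parallel> \<le> \<epsilon> C\<^sub>R \<nu> \<parallel>f\<parallel>\<close>. Subtraction of the
  \<open>N\<close>-components leaves \<open>(P M + r A) (P u - P v) = - P M Q u\<close>, and the coercivity of \<open>P M\<close> on
  \<open>N\<close> turns the smallness of \<open>Q u\<close> into \<open>\<parallel>P u - P v\<parallel> \<le> \<nu> \<parallel>Q u\<parallel>\<close>. Altogether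
  \<open>\<parallel>u - v\<parallel> \<le> \<epsilon> C\<^sub>R (\<nu> + \<nu> (1 + \<nu>)) \<parallel>f\<parallel> = \<epsilon> C\<^sub>R ((1 + \<nu>)\<^sup>2 - 1) \<parallel>f\<parallel>\<close>, which is at most
  \<open>\<kappa> \<epsilon> \<parallel>f\<parallel>\<close>. This is the lemma \<open>resolvent_difference\<close>.

  Orthogonal projections and adjoints are needed on complete subspaces of an inner product space
  that need not be complete itself; both come from the Riesz representation theorem \<open>riesz\<close>.
\<close>

section \<open>Complex inner products and the Riesz representation\<close>

lemma cinner_add_left: "cinner (x + y) z = cinner x z + cinner (y :: 'a::complex_inner) z"
  by (metis cinner_add_right cinner_commute complex_cnj_add)

lemma cinner_scaleC_left: "cinner (a *\<^sub>C x) (y :: 'a::complex_inner) = cnj a * cinner x y"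
  by (metis cinner_commute cinner_scaleC_right complex_cnj_mult)

lemma cinner_zero_right [simp]: "cinner x (0 :: 'a::complex_inner) = 0"
  using cinner_add_right[of x 0 0] by simp

lemma cinner_scaleR_right: "cinner x (r *\<^sub>R y) = of_real r * cinner x (y :: 'a::complex_inner)"
  by (simp add: scaleR_eq_scaleC cinner_scaleC_right)

lemma cinner_scaleR_left: "cinner (r *\<^sub>R x) y = of_real r * cinner x (y :: 'a::complex_inner)"
  by (simp add: scaleR_eq_scaleC cinner_scaleC_left)

lemma cinner_minus_right: "cinner x (- y) = - cinner x (y :: 'a::complex_inner)"
  using cinner_scaleR_right[of x "-1" y] by simp

lemma cinner_minus_left: "cinner (- x) y = - cinner x (y :: 'a::complex_inner)"
  using cinner_scaleR_left[of "-1" x y] by simp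

lemma cinner_diff_right: "cinner x (y - z) = cinner x y - cinner x (z :: 'a::complex_inner)"
  using cinner_add_right[of x y "- z"] by (simp add: cinner_minus_right)

lemma cinner_diff_left: "cinner (x - y) z = cinner x z - cinner y (z :: 'a::complex_inner)"
  using cinner_add_left[of x "- y" z] by (simp add: cinner_minus_left)

lemma cinner_self_eq_0_iff [simp]: "cinner x x = 0 \<longleftrightarrow> x = (0 :: 'a::complex_inner)"
proof
  assume "cinner x x = 0"
  then have "inner x x = 0" by (simp add: inner_eq_Re_cinner)
  then show "x = 0" by simp
qed simp

lemma subspace_scaleR:
  "complex_vector.subspace V \<Longrightarrow> x \<in> V \<Longrightarrow> r *\<^sub>R (x :: 'a::complex_inner) \<in> V"
  by (simp add: scaleR_eq_scaleC complex_vector.subspace_scale)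

text \<open>The representing vector minimises \<open>\<parallel>x\<parallel>\<^sup>2 - 2 g x\<close> on \<open>V\<close>: minimising sequences are Cauchy by the
  parallelogram law, and the first variation vanishes at the minimiser.\<close>

lemma real_riesz:
  fixes V :: "'a::real_inner set" and g :: "'a \<Rightarrow> real"
  assumes "complete V" and zero: "0 \<in> V"
    and add_mem: "\<And>x y. x \<in> V \<Longrightarrow> y \<in> V \<Longrightarrow> x + y \<in> V"
    and scale_mem: "\<And>r x. x \<in> V \<Longrightarrow> r *\<^sub>R x \<in> V"
    and g_add: "\<And>x y. x \<in> V \<Longrightarrow> y \<in> V \<Longrightarrow> g (x + y) = g x + g y"
    and g_scale: "\<And>r x. x \<in> V \<Longrightarrow> g (r *\<^sub>R x) = r * g x"
    and g_bound: "\<And>x. x \<in> V \<Longrightarrow> \<bar>g x\<bar> \<le> C * norm x"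
  obtains z where "z \<in> V" and "\<And>x. x \<in> V \<Longrightarrow> g x = inner z x"
proof -
  define J where "J x = (norm x)\<^sup>2 - 2 * g x" for x
  define m where "m = Inf (J ` V)"
  have J_ge: "- (C\<^sup>2) \<le> J x" if "x \<in> V" for x
  proof -
    have "0 \<le> (norm x - C)\<^sup>2" by simp
    then show ?thesis using g_bound[OF that] by (auto simp: J_def power2_eq_square algebra_simps)
  qed
  then have m_le: "m \<le> J x" if "x \<in> V" for x
    unfolding m_def using that by (intro cInf_lower) (auto intro!: bdd_belowI2)
  have "\<exists>x\<in>V. J x < m + inverse (Suc n)" for n
    using cInf_lessD[of "J ` V" "m + inverse (Suc n)"] zero unfolding m_def by auto
  then obtain X where X: "\<And>n. X n \<in> V" and JX: "\<And>n. J (X n) < m + inverse (Suc n)"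
    by metis
  have diff_mem: "x - y \<in> V" if "x \<in> V" "y \<in> V" for x y
    using add_mem[OF that(1) scale_mem[OF that(2), of "-1"]] by simp
  have g_diff: "g (x - y) = g x - g y" if "x \<in> V" "y \<in> V" for x y
    using g_add[OF that(1) scale_mem[OF that(2), of "-1"]] g_scale[OF that(2), of "-1"] by simp
  \<comment> \<open>The parallelogram law, evaluated at the midpoint.\<close>
  have para: "(norm (x - y))\<^sup>2 \<le> 2 * (J x - m) + 2 * (J y - m)" if "x \<in> V" "y \<in> V" for x y
  proof -
    have mid: "(norm ((1/2) *\<^sub>R (x + y)))\<^sup>2
        = ((norm x)\<^sup>2 + (norm y)\<^sup>2) / 2 - (norm (x - y))\<^sup>2 / 4"
      by (simp only: power2_norm_eq_inner)
        (simp add: inner_add_left inner_add_right inner_diff_left inner_diff_right inner_commute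
          field_simps)
    have "m \<le> J ((1/2) *\<^sub>R (x + y))" using that by (intro m_le scale_mem add_mem)
    also have "\<dots> = (J x + J y) / 2 - (norm (x - y))\<^sup>2 / 4"
      unfolding J_def mid g_scale[OF add_mem[OF that]] g_add[OF that] by (simp add: field_simps)
    finally show ?thesis by (simp add: field_simps)
  qed
  have "Cauchy X"
  proof (rule metric_CauchyI)
    fix e :: real assume "0 < e"
    then obtain K where K: "inverse (real (Suc K)) < e\<^sup>2 / 4"
      using reals_Archimedean[of "e\<^sup>2 / 4"] by auto
    have small: "J (X n) - m < e\<^sup>2 / 4" if "n \<ge> K" for n
    proof -
      have "inverse (real (Suc n)) \<le> inverse (real (Suc K))" using that by simp
      then show ?thesis using JX[of n] K by linarith
    qed
    have "dist (X i) (X j) < e" if "i \<ge> K" "j \<ge> K" for i j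
    proof -
      have "(norm (X i - X j))\<^sup>2 < e\<^sup>2"
        using para[OF X X, of i j] small[OF that(1)] small[OF that(2)] by simp
      then show ?thesis using \<open>0 < e\<close> by (simp add: dist_norm power2_less_imp_less)
    qed
    then show "\<exists>K. \<forall>i\<ge>K. \<forall>j\<ge>K. dist (X i) (X j) < e" by blast
  qed
  with \<open>complete V\<close> X obtain z where z: "z \<in> V" and lim: "X \<longlonglongrightarrow> z"
    unfolding complete_def by blast
  have "(\<lambda>n. g (X n) - g z) \<longlonglongrightarrow> 0"
  proof (rule Lim_null_comparison)
    show "\<forall>\<^sub>F n in sequentially. norm (g (X n) - g z) \<le> C * norm (X n - z)"
      using g_bound[OF diff_mem[OF X z]] g_diff[OF X z] by simp
    show "(\<lambda>n. C * norm (X n - z)) \<longlonglongrightarrow> 0"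
      using lim by (intro tendsto_eq_intros | simp)+
  qed
  then have "(\<lambda>n. g (X n)) \<longlonglongrightarrow> g z" by (simp add: LIM_zero_iff)
  then have "(\<lambda>n. J (X n)) \<longlonglongrightarrow> J z"
    unfolding J_def using lim by (intro tendsto_intros)
  moreover have "(\<lambda>n. m + inverse (Suc n)) \<longlonglongrightarrow> m"
    using LIMSEQ_inverse_real_of_nat_add[of m] by simp
  ultimately have Jz: "J z \<le> m"
    using JX less_imp_le by (blast intro: LIMSEQ_le)
  have "g x = inner z x" if "x \<in> V" for x
  proof (cases "x = 0")
    case True
    then show ?thesis using g_scale[OF zero, of 0] by simp
  next
    case False
    define d where "d = inner z x - g x"
    define t where "t = - d / (norm x)\<^sup>2"
    have "J z \<le> J (z + t *\<^sub>R x)"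
      using Jz m_le[OF add_mem[OF z scale_mem[OF that]]] by (rule order_trans)
    also have "\<dots> = J z + 2 * t * d + t\<^sup>2 * (norm x)\<^sup>2"
      using z that
      by (simp add: J_def g_add g_scale scale_mem d_def power2_norm_eq_inner inner_simps
          inner_commute algebra_simps power2_eq_square[of t])
    also have "\<dots> = J z - d\<^sup>2 / (norm x)\<^sup>2"
      using False by (simp add: t_def field_simps power2_eq_square)
    finally have "d\<^sup>2 / (norm x)\<^sup>2 \<le> 0" by simp
    then have "d = 0" using False by (simp add: divide_le_0_iff)
    then show ?thesis by (simp add: d_def)
  qed
  with z show thesis by (rule that)
qed

text \<open>The real part of \<open>f\<close> determines \<open>f\<close>, because \<open>Im (f x) = - Re (f (\<i> x))\<close>. So the real
  representation applies, and only the real part needs a bound.\<close>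

lemma riesz:
  fixes V :: "'a::complex_inner set" and f :: "'a \<Rightarrow> complex"
  assumes V: "hilbert_space V"
    and f_add: "\<And>x y. x \<in> V \<Longrightarrow> y \<in> V \<Longrightarrow> f (x + y) = f x + f y"
    and f_scale: "\<And>a x. x \<in> V \<Longrightarrow> f (a *\<^sub>C x) = a * f x"
    and f_bound: "\<And>x. x \<in> V \<Longrightarrow> \<bar>Re (f x)\<bar> \<le> C * norm x"
  obtains z where "z \<in> V" and "\<And>x. x \<in> V \<Longrightarrow> f x = cinner z x"
proof -
  have sub: "complex_vector.subspace V" and "complete V"
    using V by (auto simp: hilbert_space_def)
  obtain z where z: "z \<in> V" and Re: "\<And>x. x \<in> V \<Longrightarrow> Re (f x) = inner z x"
  proof (rule real_riesz[where g = "\<lambda>x. Re (f x)"])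
    show "complete V" by fact
    show "Re (f (r *\<^sub>R x)) = r * Re (f x)" if "x \<in> V" for r x
      using f_scale[OF that, of "of_real r"] by (simp add: scaleR_eq_scaleC)
  qed (use sub f_add f_bound in \<open>auto simp: complex_vector.subspace_0 complex_vector.subspace_add
      subspace_scaleR\<close>)
  have "f x = cinner z x" if "x \<in> V" for x
  proof (rule complex_eqI)
    show "Re (f x) = Re (cinner z x)" using Re[OF that] by (simp add: inner_eq_Re_cinner)
    have "Re (f (\<i> *\<^sub>C x)) = Re (cinner z (\<i> *\<^sub>C x))"
      using Re complex_vector.subspace_scale[OF sub that] by (simp add: inner_eq_Re_cinner)
    then show "Im (f x) = Im (cinner z x)"
      using f_scale[OF that] by (simp add: cinner_scaleC_right)
  qed
  with z show thesis by (rule that)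
qed


section \<open>Operators and their graphs\<close>

lemma operators_iff:
  "T \<in> operators H K \<longleftrightarrow> T \<subseteq> H \<times> K \<and> single_valued T \<and> (0, 0) \<in> T \<and>
     (\<forall>x y x' y'. (x, y) \<in> T \<longrightarrow> (x', y') \<in> T \<longrightarrow> (x + x', y + y') \<in> T) \<and>
     (\<forall>a x y. (x, y) \<in> T \<longrightarrow> (a *\<^sub>C x, a *\<^sub>C y) \<in> T)"
  unfolding operators_def complex_vector.subspace_def
  by (auto simp: scaleC_prod_def zero_prod_def Ball_def)

lemma op_zero: "T \<in> operators H K \<Longrightarrow> (0, 0) \<in> T"
  and op_plus: "T \<in> operators H K \<Longrightarrow> (x, y) \<in> T \<Longrightarrow> (x', y') \<in> T \<Longrightarrow> (x + x', y + y') \<in> T"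
  and op_scaleC: "T \<in> operators H K \<Longrightarrow> (x, y) \<in> T \<Longrightarrow> (a *\<^sub>C x, a *\<^sub>C y) \<in> T"
  and op_unique: "T \<in> operators H K \<Longrightarrow> (x, y) \<in> T \<Longrightarrow> (x, y') \<in> T \<Longrightarrow> y = y'"
  and op_dom: "T \<in> operators H K \<Longrightarrow> (x, y) \<in> T \<Longrightarrow> x \<in> H"
  and op_ran: "T \<in> operators H K \<Longrightarrow> (x, y) \<in> T \<Longrightarrow> y \<in> K"
  by (auto simp: operators_iff single_valued_def)

lemma op_scaleR: "T \<in> operators H K \<Longrightarrow> (x, y) \<in> T \<Longrightarrow> (r *\<^sub>R x, r *\<^sub>R y) \<in> T"
  by (simp add: scaleR_eq_scaleC op_scaleC)

lemma op_diff: "T \<in> operators H K \<Longrightarrow> (x, y) \<in> T \<Longrightarrow> (x', y') \<in> T \<Longrightarrow> (x - x', y - y') \<in> T"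
  using op_plus[of T H K x y "- x'" "- y'"] op_scaleR[of T H K x' y' "-1"] by simp

lemma bounded_operators_operators: "T \<in> bounded_operators H K \<Longrightarrow> T \<in> operators H K"
  by (simp add: bounded_operators_def)

lemma bounded_operators_total: "T \<in> bounded_operators H K \<Longrightarrow> x \<in> H \<Longrightarrow> \<exists>y\<in>K. (x, y) \<in> T"
  by (auto simp: bounded_operators_def operators_def)

lemma bounded_operators_bound:
  assumes "T \<in> bounded_operators H K"
  obtains C where "C \<ge> 0" and "\<And>x y. (x, y) \<in> T \<Longrightarrow> norm y \<le> C * norm x"
proof -
  obtain C where C: "\<And>x y. (x, y) \<in> T \<Longrightarrow> norm y \<le> C * norm x"
    using assms by (auto simp: bounded_operators_def op_bounded_def)
  have "norm y \<le> \<bar>C\<bar> * norm x" if "(x, y) \<in> T" for x y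
    using C[OF that] by (meson abs_ge_self mult_right_mono norm_ge_zero order_trans)
  then show thesis by (intro that[of "\<bar>C\<bar>"]) auto
qed

lemma bdd_above_op_norm:
  assumes "T \<in> bounded_operators H K"
  shows "bdd_above {norm y |x y. (x, y) \<in> T \<and> norm x \<le> 1}"
proof -
  obtain C where "C \<ge> 0" and C: "\<And>x y. (x, y) \<in> T \<Longrightarrow> norm y \<le> C * norm x"
    using bounded_operators_bound[OF assms] by blast
  show ?thesis
  proof (rule bdd_aboveI[where M = C])
    fix r assume "r \<in> {norm y |x y. (x, y) \<in> T \<and> norm x \<le> 1}"
    then obtain x y where "(x, y) \<in> T" "norm x \<le> 1" "r = norm y" by blast
    then show "r \<le> C"
      using C[of x y] mult_left_mono[of "norm x" 1 C] \<open>C \<ge> 0\<close> by simp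
  qed
qed

lemma norm_le_op_norm:
  assumes T: "T \<in> bounded_operators H K" and xy: "(x, y) \<in> T"
  shows "norm y \<le> op_norm T * norm x"
proof (cases "x = 0")
  case True
  have "y = 0"
    using op_unique op_zero bounded_operators_operators[OF T] xy True by blast
  then show ?thesis using True by simp
next
  case False
  have "((1 / norm x) *\<^sub>R x, (1 / norm x) *\<^sub>R y) \<in> T"
    using bounded_operators_operators[OF T] xy by (rule op_scaleR)
  then have "norm ((1 / norm x) *\<^sub>R y) \<le> op_norm T"
    unfolding op_norm_def using False bdd_above_op_norm[OF T]
    by (intro cSup_upper) (auto intro!: exI)
  then show ?thesis using False by (simp add: field_simps)
qed

lemma op_norm_nonneg:
  assumes T: "T \<in> bounded_operators H K"
  shows "op_norm T \<ge> 0"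
proof -
  have "(0, 0) \<in> T" using op_zero bounded_operators_operators[OF T] by blast
  then have "norm (0 :: 'b) \<le> op_norm T"
    unfolding op_norm_def using bdd_above_op_norm[OF T] by (intro cSup_upper) force+
  then show ?thesis by simp
qed

lemma op_norm_le:
  assumes "(0, 0) \<in> T" and "C \<ge> 0" and C: "\<And>x y. (x, y) \<in> T \<Longrightarrow> norm y \<le> C * norm x"
  shows "op_norm T \<le> C"
  unfolding op_norm_def
proof (rule cSup_least)
  show "{norm y |x y. (x, y) \<in> T \<and> norm x \<le> 1} \<noteq> {}" using assms(1) by force
  fix r assume "r \<in> {norm y |x y. (x, y) \<in> T \<and> norm x \<le> 1}"
  then obtain x y where "(x, y) \<in> T" "norm x \<le> 1" "r = norm y" by blast
  then show "r \<le> C"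
    using C[of x y] mult_left_mono[of "norm x" 1 C] \<open>C \<ge> 0\<close> by simp
qed

lemma op_add_iff: "(x, w) \<in> S +\<^sub>o T \<longleftrightarrow> (\<exists>y z. (x, y) \<in> S \<and> (x, z) \<in> T \<and> w = y + z)"
  by (auto simp: op_add_def)

lemma op_scale_iff: "(x, w) \<in> r *\<^sub>o T \<longleftrightarrow> (\<exists>y. (x, y) \<in> T \<and> w = r *\<^sub>R y)"
  by (auto simp: op_scale_def)

lemma op_diff_iff: "(x, w) \<in> S -\<^sub>o T \<longleftrightarrow> (\<exists>y z. (x, y) \<in> S \<and> (x, z) \<in> T \<and> w = y - z)"
  by (auto simp: op_add_iff op_scale_iff)

lemma op_scale_operators:
  assumes "T \<in> operators H K" "complex_vector.subspace K"
  shows "r *\<^sub>o T \<in> operators H K"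
  unfolding operators_iff
proof (intro conjI allI impI)
  show "r *\<^sub>o T \<subseteq> H \<times> K"
    using assms by (auto simp: op_scale_iff dest: op_dom op_ran intro!: subspace_scaleR)
  show "single_valued (r *\<^sub>o T)"
    using assms by (auto simp: op_scale_iff single_valued_def dest: op_unique)
  show "(0, 0) \<in> r *\<^sub>o T"
    using assms by (force simp: op_scale_iff dest: op_zero)
next
  fix x y x' y' assume "(x, y) \<in> r *\<^sub>o T" "(x', y') \<in> r *\<^sub>o T"
  then show "(x + x', y + y') \<in> r *\<^sub>o T"
    using op_plus[OF assms(1)] unfolding op_scale_iff by (metis scaleR_add_right)
next
  fix a x y assume "(x, y) \<in> r *\<^sub>o T"
  then show "(a *\<^sub>C x, a *\<^sub>C y) \<in> r *\<^sub>o T"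
    using op_scaleC[OF assms(1)]
    unfolding op_scale_iff scaleR_eq_scaleC by (metis scaleC_scaleC mult.commute)
qed

lemma op_add_operators:
  assumes "S \<in> operators H K" "T \<in> operators H K" "complex_vector.subspace K"
  shows "S +\<^sub>o T \<in> operators H K"
  unfolding operators_iff
proof (intro conjI allI impI)
  show "S +\<^sub>o T \<subseteq> H \<times> K"
    using assms by (auto simp: op_add_iff dest: op_dom op_ran intro!: complex_vector.subspace_add)
  show "single_valued (S +\<^sub>o T)"
    using assms by (auto simp: op_add_iff single_valued_def dest: op_unique)
  show "(0, 0) \<in> S +\<^sub>o T"
    using assms by (force simp: op_add_iff dest: op_zero)
next
  fix x y x' y' assume "(x, y) \<in> S +\<^sub>o T" "(x', y') \<in> S +\<^sub>o T"
  then obtain s t s' t' where "(x, s) \<in> S" "(x, t) \<in> T" "y = s + t"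
    "(x', s') \<in> S" "(x', t') \<in> T" "y' = s' + t'" by (auto simp: op_add_iff)
  then show "(x + x', y + y') \<in> S +\<^sub>o T"
    using op_plus[OF assms(1), of x s x' s'] op_plus[OF assms(2), of x t x' t']
    unfolding op_add_iff
    by (intro exI[of _ "s + s'"] exI[of _ "t + t'"]) (simp add: add_ac)
next
  fix a x y assume "(x, y) \<in> S +\<^sub>o T"
  then show "(a *\<^sub>C x, a *\<^sub>C y) \<in> S +\<^sub>o T"
    using op_scaleC[OF assms(1)] op_scaleC[OF assms(2)]
    unfolding op_add_iff by (metis scaleC_add_right)
qed

lemma op_comp_operators:
  assumes S: "S \<in> operators K L" and T: "T \<in> operators H K"
  shows "S \<cdot>\<^sub>o T \<in> operators H L"
  unfolding operators_iff
proof (intro conjI allI impI)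
  show "S \<cdot>\<^sub>o T \<subseteq> H \<times> L" using assms by (auto dest: op_dom op_ran)
  show "single_valued (S \<cdot>\<^sub>o T)"
    using assms by (auto simp: operators_iff intro: single_valued_relcomp)
  show "(0, 0) \<in> S \<cdot>\<^sub>o T" using assms by (blast dest: op_zero)
qed (use op_plus[OF S] op_plus[OF T] op_scaleC[OF S] op_scaleC[OF T] in blast)+

lemma op_comp_bounded_operators:
  assumes S: "S \<in> bounded_operators K L" and T: "T \<in> bounded_operators H K"
  shows "S \<cdot>\<^sub>o T \<in> bounded_operators H L"
proof -
  obtain C D where "C \<ge> 0" "D \<ge> 0"
    and C: "\<And>x y. (x, y) \<in> S \<Longrightarrow> norm y \<le> C * norm x"
    and D: "\<And>x y. (x, y) \<in> T \<Longrightarrow> norm y \<le> D * norm x"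
    using S T by (metis bounded_operators_bound)
  have "norm z \<le> C * D * norm x" if "(x, y) \<in> T" "(y, z) \<in> S" for x y z
    using C[OF that(2)] mult_left_mono[OF D[OF that(1)] \<open>C \<ge> 0\<close>] by (simp add: mult.assoc)
  then have "op_bounded (S \<cdot>\<^sub>o T)" unfolding op_bounded_def by blast
  moreover have "Domain (S \<cdot>\<^sub>o T) = H"
    using bounded_operators_total[OF S] bounded_operators_total[OF T]
      op_dom[OF bounded_operators_operators[OF T]] by blast
  ultimately show ?thesis
    using op_comp_operators bounded_operators_operators S T
    unfolding bounded_operators_def by blast
qed

text \<open>A linear map that is bounded below is injective, so its inverse is again the graph of an
  operator.\<close>

lemma converse_bounded_operators:
  assumes T: "T \<in> operators H K"
    and surj: "\<And>y. y \<in> K \<Longrightarrow> \<exists>x. (x, y) \<in> T"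
    and bound: "\<And>x y. (x, y) \<in> T \<Longrightarrow> norm x \<le> C * norm y"
  shows "T\<inverse> \<in> bounded_operators K H"
proof -
  have "x = x'" if "(x, y) \<in> T" "(x', y) \<in> T" for x x' y
    using bound[OF op_diff[OF T that]] by simp
  then have "T\<inverse> \<in> operators K H"
    using T unfolding operators_iff[of "T\<inverse>"]
    by (auto simp: single_valued_def dest: op_dom op_ran op_zero op_plus op_scaleC)
  moreover have "Domain (T\<inverse>) = K" using surj T by (auto dest: op_ran)
  moreover have "op_bounded (T\<inverse>)" using bound by (auto simp: op_bounded_def)
  ultimately show ?thesis by (simp add: bounded_operators_def)
qed

text \<open>The value of the adjoint at \<open>y\<close> represents the functional \<open>x \<mapsto> \<langle>y, T x\<rangle>\<close>.\<close>

lemma adjoint_op_total: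
  assumes H: "hilbert_space H" and T: "T \<in> bounded_operators H K" and y: "y \<in> K"
  obtains z where "(y, z) \<in> adjoint_op H K T"
proof -
  have op: "T \<in> operators H K" using T by (rule bounded_operators_operators)
  obtain C where "C \<ge> 0" and C: "\<And>x y. (x, y) \<in> T \<Longrightarrow> norm y \<le> C * norm x"
    using bounded_operators_bound[OF T] by blast
  obtain t where t: "\<And>x. x \<in> H \<Longrightarrow> (x, t x) \<in> T"
    using bounded_operators_total[OF T] by metis
  have t_eq: "w = t x" if "(x, w) \<in> T" for x w
    using op_unique[OF op that t[OF op_dom[OF op that]]] .
  obtain z where z: "z \<in> H" and rep: "\<And>x. x \<in> H \<Longrightarrow> cinner y (t x) = cinner z x"
  proof (rule riesz[OF H, where f = "\<lambda>x. cinner y (t x)" and C = "norm y * C"])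
    fix x x' assume "x \<in> H" "x' \<in> H"
    then have "t (x + x') = t x + t x'" using t_eq[OF op_plus[OF op t t]] by simp
    then show "cinner y (t (x + x')) = cinner y (t x) + cinner y (t x')"
      by (simp add: cinner_add_right)
  next
    fix a x assume "x \<in> H"
    then have "t (a *\<^sub>C x) = a *\<^sub>C t x" using t_eq[OF op_scaleC[OF op t]] by simp
    then show "cinner y (t (a *\<^sub>C x)) = a * cinner y (t x)"
      by (simp add: cinner_scaleC_right)
  next
    fix x assume "x \<in> H"
    have "\<bar>Re (cinner y (t x))\<bar> \<le> norm y * norm (t x)"
      using Cauchy_Schwarz_ineq2[of y "t x"] by (simp add: inner_eq_Re_cinner)
    also have "\<dots> \<le> norm y * (C * norm x)"
      using C[OF t[OF \<open>x \<in> H\<close>]] by (simp add: mult_left_mono)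
    finally show "\<bar>Re (cinner y (t x))\<bar> \<le> norm y * C * norm x" by (simp add: mult.assoc)
  qed blast
  have "cinner w y = cinner x z" if "(x, w) \<in> T" for x w
    using rep[OF op_dom[OF op that]] t_eq[OF that] cinner_commute by metis
  then have "(y, z) \<in> adjoint_op H K T"
    using y z by (auto simp: adjoint_op_def)
  then show thesis by (rule that)
qed

text \<open>The domain of \<open>Re M\<close> is the intersection of the domains of \<open>M\<close> and \<open>M\<^sup>*\<close>. The bound
  reaches every \<open>x \<in> H\<close> because \<open>M\<^sup>*\<close> is defined everywhere.\<close>

lemma coercive_if_real_part_ge:
  assumes H: "hilbert_space H" and M: "M \<in> bounded_operators H H"
    and ge: "op_ge (real_part_op H M) c" and xy: "(x, y) \<in> M"
  shows "c * (norm x)\<^sup>2 \<le> Re (cinner x y)"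
proof -
  have "x \<in> H" using bounded_operators_operators[OF M] xy by (rule op_dom)
  then obtain z where z: "(x, z) \<in> adjoint_op H H M"
    using adjoint_op_total[OF H M] by blast
  then have "cinner y x = cinner x z" using xy by (auto simp: adjoint_op_def)
  then have "Re (cinner x z) = Re (cinner x y)"
    using cinner_commute[of x y] by simp
  moreover have "(x, (1 / 2) *\<^sub>R (y + z)) \<in> real_part_op H M"
    using xy z by (auto simp: real_part_op_def op_scale_iff op_add_iff)
  ultimately show ?thesis
    using ge by (auto simp: op_ge_def cinner_scaleR_right cinner_add_right)
qed


section \<open>Orthogonal projections\<close>

lemma hilbert_space_closed_subspace:
  assumes "hilbert_space H" "closed_subspace N H"
  shows "hilbert_space N"
  using assms complete_closed_subset[of N H] by (auto simp: hilbert_space_def closed_subspace_def)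

text \<open>The projection of \<open>x\<close> onto \<open>V\<close> represents the functional \<open>\<langle>x, \<cdot>\<rangle>\<close> on \<open>V\<close>.\<close>

lemma orthogonal_decomposition:
  assumes V: "hilbert_space V"
  obtains v where "v \<in> V" and "\<And>w. w \<in> V \<Longrightarrow> cinner w (x - v) = 0"
proof (rule riesz[OF V, where f = "cinner x" and C = "norm x"])
  show "\<bar>Re (cinner x y)\<bar> \<le> norm x * norm y" for y
    using Cauchy_Schwarz_ineq2[of x y] by (simp add: inner_eq_Re_cinner)
next
  fix v assume "v \<in> V" and rep: "\<And>w. w \<in> V \<Longrightarrow> cinner x w = cinner v w"
  moreover have "cinner w (x - v) = 0" if "w \<in> V" for w
    using rep[OF that] cinner_commute[of w x] cinner_commute[of w v]
    by (simp add: cinner_diff_right)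
  ultimately show thesis by (intro that)
qed (simp_all add: cinner_add_right cinner_scaleC_right)

lemma embedding_adj_iff:
  "(x, v) \<in> embedding_adj H V \<longleftrightarrow> x \<in> H \<and> v \<in> V \<and> (\<forall>w\<in>V. cinner w (x - v) = 0)"
  by (auto simp: adjoint_op_def cinner_diff_right)

lemma ortho_proj_eq_embedding_adj: "ortho_proj H V = embedding_adj H V"
  by (auto simp: ortho_proj_def adjoint_op_def)

text \<open>The projection onto \<open>N\<close> is used below as a function \<open>P\<close> on \<open>H\<close>; the projection onto \<open>R\<close> is
  then \<open>x \<mapsto> x - P x\<close>.\<close>

locale orthogonal_splitting =
  fixes H N :: "'a::complex_inner set"
  assumes hilbert: "hilbert_space H" and closed_subspace: "closed_subspace N H"
begin

abbreviation R :: "'a set" where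
  "R \<equiv> ortho_complement H N"

definition P :: "'a \<Rightarrow> 'a" where
  "P x = (SOME n. n \<in> N \<and> x - n \<in> R)"

lemma subspace_H: "complex_vector.subspace H"
  and subspace_N: "complex_vector.subspace N"
  and N_sub: "N \<subseteq> H" and R_sub: "R \<subseteq> H"
  using hilbert closed_subspace
  by (auto simp: hilbert_space_def closed_subspace_def ortho_complement_def)

lemma subspace_R: "complex_vector.subspace R"
  using subspace_H unfolding complex_vector.subspace_def ortho_complement_def
  by (auto simp: cinner_add_right cinner_scaleC_right)

lemma hilbert_N: "hilbert_space N"
  using hilbert closed_subspace by (rule hilbert_space_closed_subspace)

lemma cinner_N_R: "n \<in> N \<Longrightarrow> r \<in> R \<Longrightarrow> cinner n r = 0"
  by (simp add: ortho_complement_def)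

lemma cinner_R_N: "r \<in> R \<Longrightarrow> n \<in> N \<Longrightarrow> cinner r n = 0"
  using cinner_N_R cinner_commute[of r n] by simp

lemma P_in: "P x \<in> N" and P_rest: "x - P x \<in> R" if "x \<in> H"
proof -
  obtain n where "n \<in> N" "\<And>w. w \<in> N \<Longrightarrow> cinner w (x - n) = 0"
    using orthogonal_decomposition[OF hilbert_N] by blast
  moreover have "x - n \<in> H"
    using that \<open>n \<in> N\<close> N_sub subspace_H by (blast intro: complex_vector.subspace_diff)
  ultimately have "\<exists>n. n \<in> N \<and> x - n \<in> R" by (auto simp: ortho_complement_def)
  from someI_ex[OF this] show "P x \<in> N" "x - P x \<in> R" unfolding P_def by blast+
qed

lemma P_unique:
  assumes "n \<in> N" "r \<in> R"
  shows "P (n + r) = n"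
proof -
  have "n + r \<in> H"
    using assms N_sub R_sub subspace_H by (blast intro: complex_vector.subspace_add)
  note P = P_in[OF this] P_rest[OF this]
  have "n - P (n + r) = (n + r - P (n + r)) - r" by simp
  then have "n - P (n + r) \<in> R"
    using P assms subspace_R by (metis complex_vector.subspace_diff)
  moreover have "n - P (n + r) \<in> N"
    using P assms subspace_N by (blast intro: complex_vector.subspace_diff)
  ultimately show ?thesis using cinner_N_R by force
qed

lemma P_N: "n \<in> N \<Longrightarrow> P n = n"
  using P_unique[of n 0] subspace_R by (simp add: complex_vector.subspace_0)

lemma P_R: "r \<in> R \<Longrightarrow> P r = 0"
  using P_unique[of 0 r] subspace_N by (simp add: complex_vector.subspace_0)

lemma P_add:
  assumes "x \<in> H" "y \<in> H"
  shows "P (x + y) = P x + P y"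
proof -
  have "P (P x + P y + ((x - P x) + (y - P y))) = P x + P y"
    using assms subspace_N subspace_R P_in P_rest
    by (intro P_unique complex_vector.subspace_add) auto
  then show ?thesis by (simp add: algebra_simps)
qed

lemma P_scaleC:
  assumes "x \<in> H"
  shows "P (a *\<^sub>C x) = a *\<^sub>C P x"
proof -
  have "P (a *\<^sub>C P x + a *\<^sub>C (x - P x)) = a *\<^sub>C P x"
    using assms subspace_N subspace_R P_in P_rest
    by (intro P_unique complex_vector.subspace_scale) auto
  then show ?thesis by (simp flip: scaleC_add_right)
qed

lemma P_scaleR: "x \<in> H \<Longrightarrow> P (r *\<^sub>R x) = r *\<^sub>R P x"
  by (simp add: scaleR_eq_scaleC P_scaleC)

lemma cinner_P: "n \<in> N \<Longrightarrow> x \<in> H \<Longrightarrow> cinner n (P x) = cinner n x"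
  using cinner_N_R[OF _ P_rest, of n x] by (simp add: cinner_diff_right)

lemma norm_split:
  assumes "x \<in> H"
  shows "(norm x)\<^sup>2 = (norm (P x))\<^sup>2 + (norm (x - P x))\<^sup>2"
proof -
  have "inner (P x) (x - P x) = 0"
    using cinner_N_R[OF P_in P_rest] assms by (simp add: inner_eq_Re_cinner)
  then show ?thesis
    by (simp add: power2_norm_eq_inner inner_diff_left inner_diff_right inner_commute)
qed

lemma norm_P_le: "x \<in> H \<Longrightarrow> norm (P x) \<le> norm x"
  and norm_rest_le: "x \<in> H \<Longrightarrow> norm (x - P x) \<le> norm x"
  using norm_split by (auto intro: power2_le_imp_le)

lemma ortho_proj_N_iff: "(x, v) \<in> ortho_proj H N \<longleftrightarrow> x \<in> H \<and> v = P x"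
proof
  assume "(x, v) \<in> ortho_proj H N"
  then have v: "x \<in> H" "v \<in> N" and "\<forall>w\<in>N. cinner w (x - v) = 0"
    by (auto simp: ortho_proj_eq_embedding_adj embedding_adj_iff)
  moreover have "x - v \<in> H"
    using v N_sub subspace_H by (blast intro: complex_vector.subspace_diff)
  ultimately have "x - v \<in> R" by (simp add: ortho_complement_def)
  then show "x \<in> H \<and> v = P x" using P_unique[OF v(2)] v by force
next
  assume "x \<in> H \<and> v = P x"
  then show "(x, v) \<in> ortho_proj H N"
    using P_in P_rest cinner_N_R by (auto simp: ortho_proj_eq_embedding_adj embedding_adj_iff)
qed

text \<open>This contains \<open>R\<^sup>\<bottom> = N\<close>: a vector \<open>x - v\<close> orthogonal to \<open>R\<close> has no component in \<open>R\<close>.\<close>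

lemma embedding_adj_R_iff: "(x, v) \<in> embedding_adj H R \<longleftrightarrow> x \<in> H \<and> v = x - P x"
proof
  assume "(x, v) \<in> embedding_adj H R"
  then have x: "x \<in> H" and v: "v \<in> R" and orth: "\<forall>w\<in>R. cinner w (x - v) = 0"
    by (auto simp: embedding_adj_iff)
  have "x - P x - v \<in> R"
    using P_rest[OF x] v subspace_R by (blast intro: complex_vector.subspace_diff)
  moreover from this have "cinner (x - P x - v) (x - v - P x) = 0"
    using orth cinner_R_N P_in[OF x] by (simp add: cinner_diff_right)
  ultimately show "x \<in> H \<and> v = x - P x" using x by (simp add: algebra_simps)
next
  assume "x \<in> H \<and> v = x - P x"
  then show "(x, v) \<in> embedding_adj H R"
    using P_in P_rest cinner_R_N by (auto simp: embedding_adj_iff)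
qed

lemma ortho_proj_N_bounded: "ortho_proj H N \<in> bounded_operators H N"
proof -
  have "ortho_proj H N \<in> operators H N"
    using subspace_H P_in P_add P_scaleC
    by (auto simp: operators_iff ortho_proj_N_iff single_valued_def complex_vector.subspace_0
        complex_vector.subspace_add complex_vector.subspace_scale P_N subspace_N)
  moreover have "op_bounded (ortho_proj H N)"
    unfolding op_bounded_def using norm_P_le by (auto simp: ortho_proj_N_iff intro!: exI[of _ 1])
  moreover have "Domain (ortho_proj H N) = H" by (auto simp: ortho_proj_N_iff)
  ultimately show ?thesis by (simp add: bounded_operators_def)
qed

lemma embedding_N_bounded: "embedding N \<in> bounded_operators N H"
  using N_sub subspace_N
  by (auto simp: bounded_operators_def operators_iff single_valued_def op_bounded_def
      complex_vector.subspace_0 complex_vector.subspace_add complex_vector.subspace_scale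
      intro!: exI[of _ 1])

end


section \<open>Coercive perturbations of skew-adjoint operators\<close>

text \<open>Skew-adjointness as a maximality property: whatever satisfies the skew-symmetry relation
  against all of \<open>A\<close> already belongs to \<open>A\<close>.\<close>

lemma skew_adjoint_iff:
  assumes "complex_vector.subspace H" and A: "A = (-1) *\<^sub>o adjoint_op H H A"
  shows "(x, z) \<in> A \<longleftrightarrow> x \<in> H \<and> z \<in> H \<and> (\<forall>(u, w)\<in>A. cinner w x = - cinner u z)"
proof -
  have "(x, z) \<in> A \<longleftrightarrow> (x, - z) \<in> adjoint_op H H A"
    by (subst A, auto simp: op_scale_iff)
  also have "\<dots> \<longleftrightarrow> x \<in> H \<and> z \<in> H \<and> (\<forall>(u, w)\<in>A. cinner w x = - cinner u z)"
    using complex_vector.subspace_neg[OF assms(1)]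
    by (auto simp: adjoint_op_def cinner_minus_right dest: complex_vector.subspace_neg[OF assms(1)])
  finally show ?thesis .
qed

text \<open>A skew-adjoint operator contributes nothing to \<open>Re \<langle>x, (S + r A) x\<rangle>\<close>.\<close>

lemma coercive_plus_skew_bounded_below:
  assumes coercive: "\<And>x y. (x, y) \<in> S \<Longrightarrow> c * (norm x)\<^sup>2 \<le> Re (cinner x y)"
    and H: "complex_vector.subspace H" and A: "A = (-1) *\<^sub>o adjoint_op H H A"
    and xw: "(x, w) \<in> S +\<^sub>o r *\<^sub>o A"
  shows "c * norm x \<le> norm w"
proof -
  obtain y z where xy: "(x, y) \<in> S" and xz: "(x, z) \<in> A" and w: "w = y + r *\<^sub>R z"
    using xw by (auto simp: op_add_iff op_scale_iff)
  have "cinner z x = - cinner x z" using iffD1[OF skew_adjoint_iff[OF H A] xz] xz by auto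
  then have "Re (cinner x z) = 0"
    using cinner_commute[of z x] by (simp add: complex_eq_iff)
  then have "c * (norm x)\<^sup>2 \<le> inner x w"
    using coercive[OF xy] by (simp add: w inner_eq_Re_cinner cinner_add_right cinner_scaleR_right)
  also have "\<dots> \<le> norm x * norm w" by (rule norm_cauchy_schwarz)
  finally show ?thesis by (cases "x = 0") (auto simp: power2_eq_square)
qed

lemma coercive_plus_skew_inverse_bounded:
  assumes hilbert: "hilbert_space H" and S: "S \<in> bounded_operators H H"
    and "c > 0" and coercive: "\<And>x y. (x, y) \<in> S \<Longrightarrow> c * (norm x)\<^sup>2 \<le> Re (cinner x y)"
    and A_op: "A \<in> operators H H" and "closed A" and A: "A = (-1) *\<^sub>o adjoint_op H H A"
    and "r > 0"
  shows "(S +\<^sub>o r *\<^sub>o A)\<inverse> \<in> bounded_operators H H"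
proof -
  define B where "B = S +\<^sub>o r *\<^sub>o A"
  have H: "complex_vector.subspace H" and "complete H"
    using hilbert by (auto simp: hilbert_space_def)
  have S_op: "S \<in> operators H H" using S by (rule bounded_operators_operators)
  have B_op: "B \<in> operators H H"
    unfolding B_def using S_op A_op H by (intro op_add_operators op_scale_operators)
  have below: "norm x \<le> 1 / c * norm y" if "(x, y) \<in> B" for x y
    using coercive_plus_skew_bounded_below[OF coercive H A] that \<open>c > 0\<close>
    by (simp add: B_def field_simps)
  obtain C where "C \<ge> 0" and C: "\<And>x y. (x, y) \<in> S \<Longrightarrow> norm y \<le> C * norm x"
    using bounded_operators_bound[OF S] by blast
  \<comment> \<open>The range is closed: by coercivity, convergence of the values forces convergence of the
    arguments, and then of the values of \<open>S\<close> and \<open>A\<close> separately.\<close>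
  have limit: "\<exists>x. (x, y) \<in> B"
    if Y: "\<And>n. Y n \<in> Range B" and "Y \<longlonglongrightarrow> y" for Y :: "nat \<Rightarrow> 'a" and y
  proof -
    from Y obtain X where X: "\<And>n. (X n, Y n) \<in> B" unfolding Range_iff by metis
    then have "\<exists>s z. (X n, s) \<in> S \<and> (X n, z) \<in> A \<and> Y n = s + r *\<^sub>R z" for n
      by (force simp: B_def op_add_iff op_scale_iff)
    then obtain s z where s: "\<And>n. (X n, s n) \<in> S" and z: "\<And>n. (X n, z n) \<in> A"
      and Y_eq: "\<And>n. Y n = s n + r *\<^sub>R z n" by metis
    have "Cauchy X"
    proof (rule metric_CauchyI)
      fix e :: real assume "0 < e"
      then obtain K where K: "\<And>i j. i \<ge> K \<Longrightarrow> j \<ge> K \<Longrightarrow> dist (Y i) (Y j) < c * e"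
        using metric_CauchyD[OF LIMSEQ_imp_Cauchy[OF \<open>Y \<longlonglongrightarrow> y\<close>], of "c * e"] \<open>c > 0\<close> by auto
      have "dist (X i) (X j) < e" if "i \<ge> K" "j \<ge> K" for i j
      proof -
        have "c * dist (X i) (X j) \<le> dist (Y i) (Y j)"
          using below[OF op_diff[OF B_op X X, of i j]] \<open>c > 0\<close> by (simp add: dist_norm field_simps)
        also have "\<dots> < c * e" using that by (rule K)
        finally show ?thesis using \<open>c > 0\<close> by simp
      qed
      then show "\<exists>K. \<forall>i\<ge>K. \<forall>j\<ge>K. dist (X i) (X j) < e" by blast
    qed
    then obtain x where x: "x \<in> H" "X \<longlonglongrightarrow> x"
      using \<open>complete H\<close> op_dom[OF B_op X] unfolding complete_def by blast
    then obtain sx where sx: "(x, sx) \<in> S" using bounded_operators_total[OF S] by blast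
    have "(\<lambda>n. s n - sx) \<longlonglongrightarrow> 0"
    proof (rule Lim_null_comparison)
      show "\<forall>\<^sub>F n in sequentially. norm (s n - sx) \<le> C * norm (X n - x)"
        using C[OF op_diff[OF S_op s sx]] by simp
      show "(\<lambda>n. C * norm (X n - x)) \<longlonglongrightarrow> 0"
        using x by (intro tendsto_eq_intros | simp)+
    qed
    then have "s \<longlonglongrightarrow> sx" by (simp add: LIM_zero_iff)
    then have "(\<lambda>n. (1 / r) *\<^sub>R (Y n - s n)) \<longlonglongrightarrow> (1 / r) *\<^sub>R (y - sx)"
      using \<open>Y \<longlonglongrightarrow> y\<close> by (intro tendsto_intros)
    moreover have "(1 / r) *\<^sub>R (Y n - s n) = z n" for n using \<open>r > 0\<close> by (simp add: Y_eq)
    ultimately have "(\<lambda>n. (X n, z n)) \<longlonglongrightarrow> (x, (1 / r) *\<^sub>R (y - sx))"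
      using x by (intro tendsto_Pair) simp_all
    then have "(x, (1 / r) *\<^sub>R (y - sx)) \<in> A"
      by (rule closed_sequentially[OF \<open>closed A\<close> z])
    then have "(x, r *\<^sub>R (1 / r) *\<^sub>R (y - sx)) \<in> r *\<^sub>o A"
      unfolding op_scale_iff by blast
    then have "(x, y - sx) \<in> r *\<^sub>o A" using \<open>r > 0\<close> by simp
    then have "(x, sx + (y - sx)) \<in> B" using sx unfolding B_def op_add_iff by blast
    then have "(x, y) \<in> B" by simp
    then show ?thesis ..
  qed
  have Range_hilbert: "hilbert_space (Range B)"
    unfolding hilbert_space_def
  proof
    show "complex_vector.subspace (Range B)"
      using op_zero[OF B_op]
      by (auto intro!: complex_vector.subspaceI intro: op_plus[OF B_op] op_scaleC[OF B_op])
    show "complete (Range B)"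
      unfolding complete_def
    proof (intro allI impI)
      fix Y assume Y: "(\<forall>n. Y n \<in> Range B) \<and> Cauchy Y"
      then have "\<forall>n. Y n \<in> H" using op_ran[OF B_op] by blast
      with Y \<open>complete H\<close> obtain y where "Y \<longlonglongrightarrow> y" unfolding complete_def by blast
      then show "\<exists>l\<in>Range B. Y \<longlonglongrightarrow> l" using limit[of Y y] Y by auto
    qed
  qed
  have "\<exists>x. (x, f) \<in> B" if "f \<in> H" for f
  proof -
    obtain p where p: "p \<in> Range B" and orth: "\<And>w. w \<in> Range B \<Longrightarrow> cinner w (f - p) = 0"
      using orthogonal_decomposition[OF Range_hilbert] by blast
    define q where "q = f - p"
    have "p \<in> H" using p op_ran[OF B_op] by blast
    then have q: "q \<in> H" using that H by (simp add: q_def complex_vector.subspace_diff)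
    obtain t where qt: "(q, t) \<in> adjoint_op H H S" using adjoint_op_total[OF hilbert S q] by blast
    then have t: "t \<in> H" by (auto simp: adjoint_op_def)
    obtain sq where sq: "(q, sq) \<in> S" using bounded_operators_total[OF S q] by blast
    \<comment> \<open>Orthogonality to the range says that \<open>q\<close> lies in the kernel of the adjoint \<open>S\<^sup>* - r A\<close>,
      which is coercive like \<open>S + r A\<close> itself.\<close>
    have "(q, (1 / r) *\<^sub>R t) \<in> A"
      unfolding skew_adjoint_iff[OF H A, of q]
    proof (intro conjI q ballI, goal_cases)
      case 1
      show ?case using H t by (rule subspace_scaleR)
    next
      case (2 uw)
      obtain u w where uw: "uw = (u, w)" by (cases uw)
      with 2 have "(u, w) \<in> A" by simp
      moreover from this obtain s where us: "(u, s) \<in> S"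
        using bounded_operators_total[OF S op_dom[OF A_op]] by blast
      ultimately have "s + r *\<^sub>R w \<in> Range B"
        by (force simp: B_def op_add_iff op_scale_iff)
      then have "cinner s q + of_real r * cinner w q = 0"
        using orth[of "s + r *\<^sub>R w"] by (simp add: q_def cinner_add_left cinner_scaleR_left)
      moreover have "cinner s q = cinner u t" using qt us by (auto simp: adjoint_op_def)
      ultimately show ?case
        using \<open>r > 0\<close> unfolding uw
        by (simp add: cinner_scaleR_right field_simps add_eq_0_iff)
    qed
    then have "cinner ((1 / r) *\<^sub>R t) q = - cinner q ((1 / r) *\<^sub>R t)"
      using skew_adjoint_iff[OF H A, of q] by blast
    then have "Re (cinner q ((1 / r) *\<^sub>R t)) = 0"
      using cinner_commute[of "(1 / r) *\<^sub>R t" q] by (simp add: complex_eq_iff)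
    then have "Re (cinner q t) = 0"
      using \<open>r > 0\<close> by (simp add: cinner_scaleR_right)
    moreover have "cinner sq q = cinner q t" using qt sq by (auto simp: adjoint_op_def)
    ultimately have "Re (cinner q sq) = 0" using cinner_commute[of q sq] by simp
    then have "c * (norm q)\<^sup>2 \<le> 0" using coercive[OF sq] by simp
    then have "q = 0" using \<open>c > 0\<close> by (simp add: mult_le_0_iff)
    then have "f = p" by (simp add: q_def)
    with p show ?thesis by blast
  qed
  then show ?thesis
    unfolding B_def[symmetric] using below B_op by (intro converse_bounded_operators)
qed


section \<open>Reduction by the splitting\<close>

text \<open>The situation in a single fibre. The bounds \<open>\<mu>\<close> and \<open>\<gamma>\<close> stand for the suprema over all fibres,
  so every estimate below is uniform.\<close>

locale reduced_skew_operator = orthogonal_splitting +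
  fixes M A :: "('a \<times> 'a) set" and c \<mu> \<gamma> :: real
  assumes M: "M \<in> bounded_operators H H" and \<mu>: "op_norm M \<le> \<mu>"
    and c_pos: "c > 0" and M_ge: "op_ge (real_part_op H M) c"
    and A_op: "A \<in> operators H H" and closed_A: "closed A"
    and skew: "A = (-1) *\<^sub>o adjoint_op H H A"
    and reduces: "ortho_proj H R \<cdot>\<^sub>o A \<subseteq> A \<cdot>\<^sub>o ortho_proj H R"
    and inverse_R: "(embedding_adj H R \<cdot>\<^sub>o A \<cdot>\<^sub>o embedding R)\<inverse> \<in> bounded_operators R R"
    and \<gamma>: "op_norm ((embedding_adj H R \<cdot>\<^sub>o A \<cdot>\<^sub>o embedding R)\<inverse>) \<le> \<gamma>"
begin

lemma M_op: "M \<in> operators H H"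
  using M by (rule bounded_operators_operators)

lemma \<mu>_nonneg: "\<mu> \<ge> 0"
  using op_norm_nonneg[OF M] \<mu> by simp

lemma \<gamma>_nonneg: "\<gamma> \<ge> 0"
  using op_norm_nonneg[OF inverse_R] \<gamma> by simp

lemma norm_M_le: "(x, y) \<in> M \<Longrightarrow> norm y \<le> \<mu> * norm x"
  using norm_le_op_norm[OF M, of x y] mult_right_mono[OF \<mu>, of "norm x"] by simp

lemma M_coercive: "(x, y) \<in> M \<Longrightarrow> c * (norm x)\<^sup>2 \<le> Re (cinner x y)"
  using coercive_if_real_part_ge[OF hilbert M M_ge] .

lemma A_R_part:
  assumes xa: "(x, a) \<in> A"
  shows "(x - P x, a - P a) \<in> A"
proof -
  have "(x, a - P a) \<in> ortho_proj H R \<cdot>\<^sub>o A"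
    using xa op_ran[OF A_op xa]
    by (auto simp: ortho_proj_eq_embedding_adj embedding_adj_R_iff)
  then have "(x, a - P a) \<in> A \<cdot>\<^sub>o ortho_proj H R" using reduces by blast
  then show ?thesis by (auto simp: ortho_proj_eq_embedding_adj embedding_adj_R_iff)
qed

lemma A_N_part: "(x, a) \<in> A \<Longrightarrow> (P x, P a) \<in> A"
  using op_diff[OF A_op _ A_R_part, of x a x a] by simp

text \<open>On \<open>R\<close> the values of \<open>A\<close> lie in \<open>R\<close>, so there the operator \<open>\<iota>\<^sub>R\<^sup>* A \<iota>\<^sub>R\<close> is the restriction of \<open>A\<close>.\<close>

lemma A_R_surj:
  assumes "f \<in> R"
  obtains u where "u \<in> R" "(u, f) \<in> A"
proof -
  obtain u where "u \<in> R" "(u, f) \<in> embedding_adj H R \<cdot>\<^sub>o A \<cdot>\<^sub>o embedding R"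
    using bounded_operators_total[OF inverse_R assms] by blast
  then obtain a where ua: "(u, a) \<in> A" and "f = a - P a"
    by (auto simp: embedding_adj_R_iff)
  then have "(u, f) \<in> A" using A_R_part[OF ua] P_R[OF \<open>u \<in> R\<close>] by simp
  with \<open>u \<in> R\<close> show thesis by (rule that)
qed

lemma A_R_bounded_below:
  assumes "u \<in> R" and uf: "(u, f) \<in> A"
  shows "norm u \<le> \<gamma> * norm f"
proof -
  have "(u, f - P f) \<in> A" using A_R_part[OF uf] P_R[OF \<open>u \<in> R\<close>] by simp
  then have "f = f - P f" using op_unique[OF A_op uf] by blast
  then have "(u, f) \<in> embedding_adj H R \<cdot>\<^sub>o A \<cdot>\<^sub>o embedding R"
    using assms op_ran[OF A_op uf] embedding_adj_R_iff by blast
  then have "norm u \<le> op_norm ((embedding_adj H R \<cdot>\<^sub>o A \<cdot>\<^sub>o embedding R)\<inverse>) * norm f"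
    by (intro norm_le_op_norm[OF inverse_R]) blast
  also have "\<dots> \<le> \<gamma> * norm f" using \<gamma> by (simp add: mult_right_mono)
  finally show ?thesis .
qed

definition M\<^sub>N :: "('a \<times> 'a) set" where
  "M\<^sub>N = ortho_proj H N \<cdot>\<^sub>o M \<cdot>\<^sub>o embedding N"

definition A\<^sub>N :: "('a \<times> 'a) set" where
  "A\<^sub>N = A \<inter> N \<times> N"

lemma M\<^sub>N_iff: "(x, w) \<in> M\<^sub>N \<longleftrightarrow> x \<in> N \<and> (\<exists>m. (x, m) \<in> M \<and> w = P m)"
  by (fastforce simp: M\<^sub>N_def ortho_proj_N_iff intro: op_ran[OF M_op])

lemma M\<^sub>N_bounded: "M\<^sub>N \<in> bounded_operators N N"
  unfolding M\<^sub>N_def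
  by (intro op_comp_bounded_operators[OF _ embedding_N_bounded]
      op_comp_bounded_operators[OF ortho_proj_N_bounded] M)

lemma M\<^sub>N_coercive: "(x, y) \<in> M\<^sub>N \<Longrightarrow> c * (norm x)\<^sup>2 \<le> Re (cinner x y)"
  using M_coercive cinner_P op_ran[OF M_op] by (force simp: M\<^sub>N_iff)

lemma A\<^sub>N_op: "A\<^sub>N \<in> operators N N"
proof -
  have "complex_vector.subspace (N \<times> N)"
    using subspace_N
    by (auto simp: complex_vector.subspace_def scaleC_prod_def zero_prod_def)
  then show ?thesis
    using A_op complex_vector.subspace_inter[of A "N \<times> N"]
    by (auto simp: operators_def A\<^sub>N_def single_valued_def)
qed

lemma closed_A\<^sub>N: "closed A\<^sub>N"
  using closed_A closed_subspace
  by (simp add: A\<^sub>N_def closed_Int closed_Times closed_subspace_def)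

text \<open>An element \<open>(x, - z)\<close> of the adjoint within \<open>N\<close> satisfies the skew-symmetry relation against
  all of \<open>A\<close>, because replacing \<open>(u, w) \<in> A\<close> by \<open>(P u, P w) \<in> A\<^sub>N\<close> does not change inner products
  with \<open>x\<close> and \<open>z\<close>. Maximality of \<open>A\<close> then gives \<open>(x, z) \<in> A\<close>.\<close>

lemma skew_A\<^sub>N: "A\<^sub>N = (-1) *\<^sub>o adjoint_op N N A\<^sub>N"
proof -
  have "(x, z) \<in> A\<^sub>N \<longleftrightarrow> (x, - z) \<in> adjoint_op N N A\<^sub>N" for x z
  proof
    assume "(x, z) \<in> A\<^sub>N"
    then have "x \<in> N" "z \<in> N" and "(x, z) \<in> A" by (auto simp: A\<^sub>N_def)
    then show "(x, - z) \<in> adjoint_op N N A\<^sub>N"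
      using skew_adjoint_iff[OF subspace_H skew, of x z] complex_vector.subspace_neg[OF subspace_N]
      by (auto simp: adjoint_op_def cinner_minus_right A\<^sub>N_def)
  next
    assume "(x, - z) \<in> adjoint_op N N A\<^sub>N"
    then have x: "x \<in> N" and "- z \<in> N"
      and adj: "\<And>u w. (u, w) \<in> A\<^sub>N \<Longrightarrow> cinner w x = - cinner u z"
      by (auto simp: adjoint_op_def cinner_minus_right)
    then have z: "z \<in> N" using complex_vector.subspace_neg[OF subspace_N, of "- z"] by simp
    have "cinner w x = - cinner u z" if uw: "(u, w) \<in> A" for u w
    proof -
      have u: "u \<in> H" and w: "w \<in> H" using A_op uw by (auto dest: op_dom op_ran)
      then have "(P u, P w) \<in> A\<^sub>N" using A_N_part[OF uw] P_in by (simp add: A\<^sub>N_def)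
      then have "cinner (P w) x = - cinner (P u) z" by (rule adj)
      moreover have "cinner (w - P w) x = 0" "cinner (u - P u) z = 0"
        using cinner_R_N P_rest u w x z by blast+
      ultimately show ?thesis unfolding cinner_diff_left by (metis eq_iff_diff_eq_0)
    qed
    then have "(x, z) \<in> A"
      using x z N_sub skew_adjoint_iff[OF subspace_H skew, of x z] by blast
    then show "(x, z) \<in> A\<^sub>N" using x z by (simp add: A\<^sub>N_def)
  qed
  then show ?thesis by (force simp: op_scale_iff)
qed

lemma reduced_sum_operators: "M\<^sub>N +\<^sub>o r *\<^sub>o A\<^sub>N \<in> operators N N"
  using bounded_operators_operators[OF M\<^sub>N_bounded] A\<^sub>N_op subspace_N
  by (intro op_add_operators op_scale_operators)

lemma reduced_sum_bounded_below: "(x, y) \<in> M\<^sub>N +\<^sub>o r *\<^sub>o A\<^sub>N \<Longrightarrow> c * norm x \<le> norm y"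
  using coercive_plus_skew_bounded_below[OF M\<^sub>N_coercive subspace_N skew_A\<^sub>N] .

text \<open>The comparison operator \<open>P M P + r A\<close>, in which \<open>N\<close> and \<open>R\<close> no longer interact.\<close>

definition decoupled :: "real \<Rightarrow> ('a \<times> 'a) set" where
  "decoupled r = ortho_proj H N \<cdot>\<^sub>o M \<cdot>\<^sub>o ortho_proj H N +\<^sub>o r *\<^sub>o A"

lemma decoupled_iff:
  "(u, f) \<in> decoupled r \<longleftrightarrow> (\<exists>m a. (P u, m) \<in> M \<and> (u, a) \<in> A \<and> f = P m + r *\<^sub>R a)"
proof
  assume "(u, f) \<in> decoupled r"
  then show "\<exists>m a. (P u, m) \<in> M \<and> (u, a) \<in> A \<and> f = P m + r *\<^sub>R a"
    unfolding decoupled_def op_add_iff op_scale_iff relcomp.simps ortho_proj_N_iff by blast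
next
  assume "\<exists>m a. (P u, m) \<in> M \<and> (u, a) \<in> A \<and> f = P m + r *\<^sub>R a"
  then show "(u, f) \<in> decoupled r"
    using op_dom[OF A_op] op_ran[OF M_op]
    unfolding decoupled_def op_add_iff op_scale_iff by (metis ortho_proj_N_iff relcompI)
qed

lemma decoupled_operators: "decoupled r \<in> operators H H"
proof -
  have "ortho_proj H N \<in> operators H H"
    using bounded_operators_operators[OF ortho_proj_N_bounded] N_sub by (auto simp: operators_def)
  then show ?thesis
    unfolding decoupled_def using M_op A_op subspace_H
    by (intro op_add_operators op_scale_operators op_comp_operators)
qed

text \<open>The next two lemmas split the equations for the two operators into their components in \<open>N\<close>
  and \<open>R\<close>. They have the same left-hand sides; \<open>M + r A\<close> has the additional sources \<open>- P M (u - P u)\<close>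
  in \<open>N\<close> and \<open>- (M u - P M u)\<close> in \<open>R\<close>.\<close>

lemma decoupled_components:
  assumes "(u, f) \<in> decoupled r" "r > 0"
  shows "(P u, P f) \<in> M\<^sub>N +\<^sub>o r *\<^sub>o A\<^sub>N" and "(u - P u, (1 / r) *\<^sub>R (f - P f)) \<in> A"
proof -
  obtain m a where m: "(P u, m) \<in> M" and a: "(u, a) \<in> A" and f: "f = P m + r *\<^sub>R a"
    using assms decoupled_iff by blast
  have mH: "m \<in> H" and aH: "a \<in> H" and uH: "u \<in> H"
    using op_ran[OF M_op m] op_ran[OF A_op a] op_dom[OF A_op a] by auto
  have Pf: "P f = P m + r *\<^sub>R P a"
    using mH aH P_in N_sub subspace_H
    by (simp add: f P_add P_scaleR P_N subspace_scaleR subset_iff)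
  have "(P u, P a) \<in> A\<^sub>N" using A_N_part[OF a] P_in uH aH by (simp add: A\<^sub>N_def)
  moreover have "(P u, P m) \<in> M\<^sub>N" using m P_in[OF uH] M\<^sub>N_iff by blast
  ultimately show "(P u, P f) \<in> M\<^sub>N +\<^sub>o r *\<^sub>o A\<^sub>N"
    unfolding Pf op_add_iff op_scale_iff by blast
  have "f - P f = r *\<^sub>R (a - P a)" unfolding Pf by (simp add: f scaleR_diff_right)
  then have "(1 / r) *\<^sub>R (f - P f) = a - P a" using \<open>r > 0\<close> by simp
  then show "(u - P u, (1 / r) *\<^sub>R (f - P f)) \<in> A" using A_R_part[OF a] by simp
qed

lemma M_plus_A_components:
  assumes "(u, f) \<in> M +\<^sub>o r *\<^sub>o A" "r > 0"
  obtains m k where "(u, m) \<in> M" and "(u - P u, k) \<in> M"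
    and "(P u, P f - P k) \<in> M\<^sub>N +\<^sub>o r *\<^sub>o A\<^sub>N"
    and "(u - P u, (1 / r) *\<^sub>R (f - P f - (m - P m))) \<in> A"
proof -
  obtain m a where m: "(u, m) \<in> M" and a: "(u, a) \<in> A" and f: "f = m + r *\<^sub>R a"
    using assms by (auto simp: op_add_iff op_scale_iff)
  have mH: "m \<in> H" and aH: "a \<in> H" and uH: "u \<in> H"
    using op_ran[OF M_op m] op_ran[OF A_op a] op_dom[OF A_op a] by auto
  obtain l where l: "(P u, l) \<in> M"
    using bounded_operators_total[OF M] P_in[OF uH] N_sub by blast
  have k: "(u - P u, m - l) \<in> M" using op_diff[OF M_op m l] .
  have lH: "l \<in> H" and kH: "m - l \<in> H" using op_ran[OF M_op l] op_ran[OF M_op k] by auto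
  have Pf: "P f = P m + r *\<^sub>R P a"
    using mH aH subspace_H by (simp add: f P_add P_scaleR subspace_scaleR)
  have Pm: "P m = P (m - l) + P l" using P_add[OF kH lH] by simp
  have "(P u, P a) \<in> A\<^sub>N" using A_N_part[OF a] P_in uH aH by (simp add: A\<^sub>N_def)
  moreover have "(P u, P l) \<in> M\<^sub>N" using l P_in[OF uH] M\<^sub>N_iff by blast
  moreover have "P f - P (m - l) = P l + r *\<^sub>R P a" by (simp add: Pf Pm)
  ultimately have N: "(P u, P f - P (m - l)) \<in> M\<^sub>N +\<^sub>o r *\<^sub>o A\<^sub>N"
    unfolding op_add_iff op_scale_iff by blast
  have "f - P f - (m - P m) = r *\<^sub>R (a - P a)"
    unfolding Pf by (simp add: f scaleR_diff_right)
  then have "(u - P u, (1 / r) *\<^sub>R (f - P f - (m - P m))) \<in> A"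
    using A_R_part[OF a] \<open>r > 0\<close> by simp
  with m k N show thesis by (rule that)
qed

lemma M_plus_A_inverse_bounded: "r > 0 \<Longrightarrow> (M +\<^sub>o r *\<^sub>o A)\<inverse> \<in> bounded_operators H H"
  using hilbert M c_pos M_coercive A_op closed_A skew by (rule coercive_plus_skew_inverse_bounded)

text \<open>The equation is solved separately in \<open>N\<close> and in \<open>R\<close>.\<close>

lemma decoupled_inverse_bounded:
  assumes "r > 0"
  shows "(decoupled r)\<inverse> \<in> bounded_operators H H"
proof (rule converse_bounded_operators[OF decoupled_operators, where C = "1 / c + \<gamma> / r"])
  fix f assume f: "f \<in> H"
  have "(M\<^sub>N +\<^sub>o r *\<^sub>o A\<^sub>N)\<inverse> \<in> bounded_operators N N"
    using hilbert_N M\<^sub>N_bounded c_pos M\<^sub>N_coercive A\<^sub>N_op closed_A\<^sub>N skew_A\<^sub>N \<open>r > 0\<close>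
    by (rule coercive_plus_skew_inverse_bounded)
  then obtain n where n: "n \<in> N" "(n, P f) \<in> M\<^sub>N +\<^sub>o r *\<^sub>o A\<^sub>N"
    using bounded_operators_total P_in[OF f] by blast
  then obtain m a where m: "(n, m) \<in> M" and a: "(n, a) \<in> A" and Pf: "P f = P m + r *\<^sub>R a"
    by (auto simp: op_add_iff op_scale_iff M\<^sub>N_iff A\<^sub>N_def)
  obtain k where k: "k \<in> R" "(k, (1 / r) *\<^sub>R (f - P f)) \<in> A"
    using A_R_surj subspace_scaleR[OF subspace_R P_rest[OF f]] by blast
  have "(n + k, a + (1 / r) *\<^sub>R (f - P f)) \<in> A" using op_plus[OF A_op a k(2)] .
  moreover have "(P (n + k), m) \<in> M" using m P_unique n k by simp
  moreover have "f = P m + r *\<^sub>R (a + (1 / r) *\<^sub>R (f - P f))"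
    using \<open>r > 0\<close> Pf by (simp add: scaleR_add_right algebra_simps)
  ultimately show "\<exists>u. (u, f) \<in> decoupled r" unfolding decoupled_iff by blast
next
  fix u f assume uf: "(u, f) \<in> decoupled r"
  have u: "u \<in> H" and f: "f \<in> H" using uf decoupled_operators by (auto dest: op_dom op_ran)
  have "norm (P u) \<le> norm (P f) / c"
    using reduced_sum_bounded_below[OF decoupled_components(1)[OF uf \<open>r > 0\<close>]] c_pos
    by (simp add: field_simps)
  also have "\<dots> \<le> 1 / c * norm f" using norm_P_le[OF f] c_pos by (simp add: divide_right_mono)
  finally have N: "norm (P u) \<le> 1 / c * norm f" .
  have "norm (u - P u) \<le> \<gamma> * norm ((1 / r) *\<^sub>R (f - P f))"
    using A_R_bounded_below[OF P_rest[OF u] decoupled_components(2)[OF uf \<open>r > 0\<close>]] .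
  also have "\<dots> = \<gamma> / r * norm (f - P f)" using \<open>r > 0\<close> by simp
  also have "\<dots> \<le> \<gamma> / r * norm f"
    using norm_rest_le[OF f] \<gamma>_nonneg \<open>r > 0\<close> by (intro mult_left_mono) auto
  finally have "norm (u - P u) \<le> \<gamma> / r * norm f" .
  with N show "norm u \<le> (1 / c + \<gamma> / r) * norm f"
    using norm_triangle_ineq[of "P u" "u - P u"] by (simp add: algebra_simps)
qed

text \<open>Coercivity controls \<open>u\<close>; the \<open>R\<close>-equation then makes \<open>u - P u\<close> of order \<open>1 / r\<close>, and this is the
  only source by which the two \<open>N\<close>-equations differ.\<close>

lemma resolvent_difference:
  assumes "r > 0" and u: "(u, f) \<in> M +\<^sub>o r *\<^sub>o A" and v: "(v, f) \<in> decoupled r"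
  shows "norm (u - v) \<le> \<gamma> / r * ((1 + \<mu> / c)\<^sup>2 - 1) * norm f"
proof -
  obtain m k where m: "(u, m) \<in> M" and k: "(u - P u, k) \<in> M"
    and uN: "(P u, P f - P k) \<in> M\<^sub>N +\<^sub>o r *\<^sub>o A\<^sub>N"
    and uR: "(u - P u, (1 / r) *\<^sub>R (f - P f - (m - P m))) \<in> A"
    using M_plus_A_components[OF u \<open>r > 0\<close>] by blast
  note vN = decoupled_components(1)[OF v \<open>r > 0\<close>] and vR = decoupled_components(2)[OF v \<open>r > 0\<close>]
  have uH: "u \<in> H" and mH: "m \<in> H" and kH: "k \<in> H" and vH: "v \<in> H" and fH: "f \<in> H"
    using op_dom[OF M_op m] op_ran[OF M_op m] op_ran[OF M_op k] op_dom[OF decoupled_operators v]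
      op_ran[OF decoupled_operators v] by auto
  define g where "g = \<gamma> / r"
  define \<nu> where "\<nu> = \<mu> / c"
  have "g \<ge> 0" and "\<nu> \<ge> 0"
    using \<gamma>_nonneg \<mu>_nonneg \<open>r > 0\<close> c_pos by (auto simp: g_def \<nu>_def)
  have "c * norm u \<le> norm f"
    using coercive_plus_skew_bounded_below[OF M_coercive subspace_H skew u] .
  then have "\<nu> * (c * norm u) \<le> \<nu> * norm f" using \<open>\<nu> \<ge> 0\<close> by (rule mult_left_mono)
  then have m_le: "norm m \<le> \<nu> * norm f"
    using norm_M_le[OF m] c_pos by (simp add: \<nu>_def)
  have "norm (u - P u) \<le> \<gamma> * norm ((1 / r) *\<^sub>R (f - P f - (m - P m)))"
    using P_rest[OF uH] uR by (rule A_R_bounded_below)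
  also have "\<dots> = g * norm ((f - P f) - (m - P m))" using \<open>r > 0\<close> by (simp add: g_def)
  also have "\<dots> \<le> g * (norm f + \<nu> * norm f)"
    using norm_triangle_ineq4[of "f - P f" "m - P m"] norm_rest_le[OF fH] norm_rest_le[OF mH]
      m_le \<open>g \<ge> 0\<close> by (intro mult_left_mono) auto
  finally have R_le: "norm (u - P u) \<le> g * (norm f + \<nu> * norm f)" .
  have R_diff: "norm ((u - P u) - (v - P v)) \<le> g * (\<nu> * norm f)"
  proof -
    have "((u - P u) - (v - P v), (- 1 / r) *\<^sub>R (m - P m)) \<in> A"
      using op_diff[OF A_op uR vR] by (simp add: scaleR_diff_right)
    then have "norm ((u - P u) - (v - P v)) \<le> \<gamma> * norm ((- 1 / r) *\<^sub>R (m - P m))"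
      using A_R_bounded_below complex_vector.subspace_diff[OF subspace_R P_rest[OF uH] P_rest[OF vH]]
      by blast
    also have "\<dots> = g * norm (m - P m)" using \<open>r > 0\<close> by (simp add: g_def)
    also have "\<dots> \<le> g * (\<nu> * norm f)"
      using norm_rest_le[OF mH] m_le \<open>g \<ge> 0\<close> by (intro mult_left_mono) auto
    finally show ?thesis .
  qed
  have N_diff: "norm (P u - P v) \<le> \<nu> * (g * (norm f + \<nu> * norm f))"
  proof -
    have "(P u - P v, - P k) \<in> M\<^sub>N +\<^sub>o r *\<^sub>o A\<^sub>N"
      using op_diff[OF reduced_sum_operators uN vN] by simp
    then have "c * norm (P u - P v) \<le> norm (P k)"
      using reduced_sum_bounded_below by fastforce
    also have "\<dots> \<le> \<mu> * norm (u - P u)" using norm_P_le[OF kH] norm_M_le[OF k] by simp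
    finally have "norm (P u - P v) \<le> \<nu> * norm (u - P u)"
      using c_pos by (simp add: \<nu>_def field_simps)
    also have "\<dots> \<le> \<nu> * (g * (norm f + \<nu> * norm f))"
      using R_le \<open>\<nu> \<ge> 0\<close> by (rule mult_left_mono)
    finally show ?thesis .
  qed
  have "norm (u - v) \<le> norm (P u - P v) + norm ((u - P u) - (v - P v))"
    using norm_triangle_ineq[of "P u - P v" "(u - P u) - (v - P v)"] by (simp add: algebra_simps)
  also have "\<dots> \<le> g * ((1 + \<nu>)\<^sup>2 - 1) * norm f"
    using N_diff R_diff by (simp add: power2_eq_square algebra_simps)
  finally show ?thesis by (simp add: g_def \<nu>_def)
qed

lemma op_norm_resolvent_difference:
  assumes "r > 0"
  shows "op_norm ((M +\<^sub>o r *\<^sub>o A)\<inverse> -\<^sub>o (decoupled r)\<inverse>) \<le> \<gamma> / r * ((1 + \<mu> / c)\<^sup>2 - 1)"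
proof (rule op_norm_le)
  have "(M +\<^sub>o r *\<^sub>o A)\<inverse> -\<^sub>o (decoupled r)\<inverse> \<in> operators H H"
    using bounded_operators_operators M_plus_A_inverse_bounded decoupled_inverse_bounded assms subspace_H
    by (intro op_add_operators op_scale_operators) blast+
  then show "(0, 0) \<in> (M +\<^sub>o r *\<^sub>o A)\<inverse> -\<^sub>o (decoupled r)\<inverse>" by (rule op_zero)
  have "1 \<le> (1 + \<mu> / c)\<^sup>2" using \<mu>_nonneg c_pos by (intro one_le_power) simp
  then show "0 \<le> \<gamma> / r * ((1 + \<mu> / c)\<^sup>2 - 1)" using \<gamma>_nonneg assms by simp
next
  fix f d assume "(f, d) \<in> (M +\<^sub>o r *\<^sub>o A)\<inverse> -\<^sub>o (decoupled r)\<inverse>"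
  then obtain u v where "(u, f) \<in> M +\<^sub>o r *\<^sub>o A" "(v, f) \<in> decoupled r" "d = u - v"
    by (auto simp: op_diff_iff)
  then show "norm d \<le> \<gamma> / r * ((1 + \<mu> / c)\<^sup>2 - 1) * norm f"
    using resolvent_difference[OF assms] by simp
qed

end


section \<open>Uniform convergence of the inverses\<close>

theorem theorem2p2:
  fixes \<Theta> :: "'t set"
    and H N R :: "'t \<Rightarrow> 'a::complex_inner set"
    and M A :: "'t \<Rightarrow> ('a \<times> 'a) set"
    and c M_inf C_R \<kappa> :: real
  assumes "\<Theta> \<noteq> {}"
    and "\<And>\<theta>. \<theta> \<in> \<Theta> \<Longrightarrow> hilbert_space (H \<theta>)"
    and "\<And>\<theta>. \<theta> \<in> \<Theta> \<Longrightarrow> M \<theta> \<in> bounded_operators (H \<theta>) (H \<theta>)"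
    and "bdd_above ((\<lambda>\<theta>. op_norm (M \<theta>)) ` \<Theta>)"
    and "M_inf = (SUP \<theta>\<in>\<Theta>. op_norm (M \<theta>))"
    and "\<And>\<theta>. \<theta> \<in> \<Theta> \<Longrightarrow> A \<theta> \<in> operators (H \<theta>) (H \<theta>)"
    and "\<And>\<theta>. \<theta> \<in> \<Theta> \<Longrightarrow> H \<theta> \<subseteq> closure (Domain (A \<theta>))"
    and "\<And>\<theta>. \<theta> \<in> \<Theta> \<Longrightarrow> closed (A \<theta>)"
    and "c > 0"
    and "\<And>\<theta>. \<theta> \<in> \<Theta> \<Longrightarrow> op_ge (real_part_op (H \<theta>) (M \<theta>)) c"
    and "\<And>\<theta>. \<theta> \<in> \<Theta> \<Longrightarrow> A \<theta> = (-1) *\<^sub>o adjoint_op (H \<theta>) (H \<theta>) (A \<theta>)"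
    and "\<And>\<theta>. \<theta> \<in> \<Theta> \<Longrightarrow> closed_subspace (N \<theta>) (H \<theta>)"
    and "\<And>\<theta>. \<theta> \<in> \<Theta> \<Longrightarrow> R \<theta> = ortho_complement (H \<theta>) (N \<theta>)"
    and "\<And>\<theta>. \<theta> \<in> \<Theta> \<Longrightarrow> op_bounded (A \<theta> \<cdot>\<^sub>o ortho_proj (H \<theta>) (N \<theta>))"
    and "\<And>\<theta>. \<theta> \<in> \<Theta> \<Longrightarrow>
           ortho_proj (H \<theta>) (R \<theta>) \<cdot>\<^sub>o A \<theta> \<subseteq> A \<theta> \<cdot>\<^sub>o ortho_proj (H \<theta>) (R \<theta>)"
    and "\<And>\<theta>. \<theta> \<in> \<Theta> \<Longrightarrow>
           (embedding_adj (H \<theta>) (R \<theta>) \<cdot>\<^sub>o A \<theta> \<cdot>\<^sub>o embedding (R \<theta>))\<inverse> \<in> bounded_operators (R \<theta>) (R \<theta>)"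
    and "bdd_above ((\<lambda>\<theta>. op_norm ((embedding_adj (H \<theta>) (R \<theta>) \<cdot>\<^sub>o A \<theta> \<cdot>\<^sub>o embedding (R \<theta>))\<inverse>)) ` \<Theta>)"
    and "C_R = (SUP \<theta>\<in>\<Theta>. op_norm ((embedding_adj (H \<theta>) (R \<theta>) \<cdot>\<^sub>o A \<theta> \<cdot>\<^sub>o embedding (R \<theta>))\<inverse>))"
    and "\<kappa> = 2 * C_R * (1 + M_inf / c)\<^sup>2 + C_R"
  shows "\<forall>\<epsilon>::real. 0 < \<epsilon> \<and> ereal \<epsilon> < 1 / ereal (2 * C_R * M_inf) \<longrightarrow>
    (\<forall>\<theta>\<in>\<Theta>.
      (M \<theta> +\<^sub>o (1 / \<epsilon>) *\<^sub>o A \<theta>)\<inverse> \<in> bounded_operators (H \<theta>) (H \<theta>) \<and>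
      (ortho_proj (H \<theta>) (N \<theta>) \<cdot>\<^sub>o M \<theta> \<cdot>\<^sub>o ortho_proj (H \<theta>) (N \<theta>) +\<^sub>o (1 / \<epsilon>) *\<^sub>o A \<theta>)\<inverse>
        \<in> bounded_operators (H \<theta>) (H \<theta>) \<and>
      op_norm ((M \<theta> +\<^sub>o (1 / \<epsilon>) *\<^sub>o A \<theta>)\<inverse> -\<^sub>o
        (ortho_proj (H \<theta>) (N \<theta>) \<cdot>\<^sub>o M \<theta> \<cdot>\<^sub>o ortho_proj (H \<theta>) (N \<theta>) +\<^sub>o (1 / \<epsilon>) *\<^sub>o A \<theta>)\<inverse>)
        \<le> \<kappa> * \<epsilon>)"
proof (intro allI impI ballI, elim conjE)
  fix \<epsilon> :: real and \<theta> assume "0 < \<epsilon>" and \<theta>: "\<theta> \<in> \<Theta>"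
  interpret reduced_skew_operator "H \<theta>" "N \<theta>" "M \<theta>" "A \<theta>" c M_inf C_R
  proof
    show "op_norm (M \<theta>) \<le> M_inf"
      unfolding assms(5) using \<theta> assms(4) by (rule cSUP_upper)
    show "op_norm ((embedding_adj (H \<theta>) (ortho_complement (H \<theta>) (N \<theta>)) \<cdot>\<^sub>o A \<theta> \<cdot>\<^sub>o
        embedding (ortho_complement (H \<theta>) (N \<theta>)))\<inverse>) \<le> C_R"
      unfolding assms(18) assms(13)[OF \<theta>, symmetric] using \<theta> assms(17) by (rule cSUP_upper)
  qed (use assms(2,3,6,8,10,11,12,15,16)[OF \<theta>] assms(9) assms(13)[OF \<theta>] in simp_all)
  have "op_norm ((M \<theta> +\<^sub>o (1 / \<epsilon>) *\<^sub>o A \<theta>)\<inverse> -\<^sub>o (decoupled (1 / \<epsilon>))\<inverse>)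
      \<le> C_R / (1 / \<epsilon>) * ((1 + M_inf / c)\<^sup>2 - 1)"
    using \<open>0 < \<epsilon>\<close> by (intro op_norm_resolvent_difference) simp
  also have "\<dots> \<le> \<kappa> * \<epsilon>"
  proof -
    have "C_R * ((1 + M_inf / c)\<^sup>2 - 1) \<le> \<kappa>"
      using \<gamma>_nonneg by (simp add: assms(19) algebra_simps)
    then have "C_R * ((1 + M_inf / c)\<^sup>2 - 1) * \<epsilon> \<le> \<kappa> * \<epsilon>"
      using \<open>0 < \<epsilon>\<close> by (intro mult_right_mono) auto
    then show ?thesis by (simp add: mult_ac)
  qed
  finally show "(M \<theta> +\<^sub>o (1 / \<epsilon>) *\<^sub>o A \<theta>)\<inverse> \<in> bounded_operators (H \<theta>) (H \<theta>) \<and>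
      (ortho_proj (H \<theta>) (N \<theta>) \<cdot>\<^sub>o M \<theta> \<cdot>\<^sub>o ortho_proj (H \<theta>) (N \<theta>) +\<^sub>o (1 / \<epsilon>) *\<^sub>o A \<theta>)\<inverse>
        \<in> bounded_operators (H \<theta>) (H \<theta>) \<and>
      op_norm ((M \<theta> +\<^sub>o (1 / \<epsilon>) *\<^sub>o A \<theta>)\<inverse> -\<^sub>o
        (ortho_proj (H \<theta>) (N \<theta>) \<cdot>\<^sub>o M \<theta> \<cdot>\<^sub>o ortho_proj (H \<theta>) (N \<theta>) +\<^sub>o (1 / \<epsilon>) *\<^sub>o A \<theta>)\<inverse>)
        \<le> \<kappa> * \<epsilon>"
    using M_plus_A_inverse_bounded[of "1 / \<epsilon>"] decoupled_inverse_bounded[of "1 / \<epsilon>"] \<open>0 < \<epsilon>\<close>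
    by (simp add: decoupled_def)
qed

end
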